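(* Let $\phi$ satisfy the standing assumption stated in the context. Let $\gamma:\mathbb{R}^N\times\mathbb{R}^N\to 2^{\mathbb{R}^N\times\mathbb{R}^N}$ be a maximal monotone operator with $0_{\mathbb{R}^N\times\mathbb{R}^N}\in\gamma(0_{\mathbb{R}^N\times\mathbb{R}^N})$. Then for every $h\in C([0,T];\mathbb{R}^N)$ the boundary value problem $$-[\phi(u')]'+u=h(t)\ \text{ in }[0,T],\qquad \big(\phi(u')(0),-\phi(u')(T)\big)\in\gamma(u(0),u(T))$$ has a unique solution $u_h$.
   Context: $N\ge 1$ is an integer, $T>0$, $0<a<\infty$; $|\cdot|$ is the Euclidean norm on $\mathbb{R}^N$ and $B_a$ is the open ball of radius $a$ centered at $0$ in $\mathbb{R}^N$. Standing assumption on $\phi$: $\phi$ is a homeomorphism from $B_a$ onto $\mathbb{R}^N$ with $\phi(0)=0$ and $\phi=\nabla\Phi$ on $B_a$, where $\Phi:\overline{B}_a\to(-\infty,0]$ is of class $C^1$ on $B_a$, and continuous and strictly convex on $\overline{B}_a$. Operators $\gamma:\mathbb{R}^N\times\mathbb{R}^N\to 2^{\mathbb{R}^N\times\mathbb{R}^N}$ are multivalued, with domain $D(\gamma)=\{z:\gamma(z)\neq\emptyset\}$; (maximal) monotonicity is with respect to the usual inner product of $\mathbb{R}^N\times\mathbb{R}^N$. A solution of the problem is a function $u\in C^1([0,T];\mathbb{R}^N)$ with $|u'(t)|<a$ for all $t\in[0,T]$, $\phi(u')\in C^1([0,T];\mathbb{R}^N)$, $(u(0),u(T))\in D(\gamma)$,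 satisfying the differential system and the boundary condition. Here $\phi(u')(t)=\phi(u'(t))$. *)

theory Defs
  imports "HOL-Analysis.Analysis"
begin

text \<open>Points of $\mathbb{R}^N$ are elements of \<^typ>\<open>real ^ 'n\<close>, with $N$ the cardinality
  of \<^typ>\<open>'n\<close>.\<close>

definition strictly_convex_on :: "'a::real_vector set \<Rightarrow> ('a \<Rightarrow> real) \<Rightarrow> bool" where
  "strictly_convex_on S f \<longleftrightarrow> convex S \<and>
     (\<forall>x\<in>S. \<forall>y\<in>S. \<forall>t. x \<noteq> y \<and> 0 < t \<and> t < 1 \<longrightarrow>
        f ((1 - t) *\<^sub>R x + t *\<^sub>R y) < (1 - t) * f x + t * f y)"

definition C1_potential_on :: "'a::real_inner set \<Rightarrow> ('a \<Rightarrow> real) \<Rightarrow> ('a \<Rightarrow> 'a) \<Rightarrow> bool" where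
  "C1_potential_on S F g \<longleftrightarrow> (\<forall>x\<in>S. GDERIV F x :> g x) \<and> continuous_on S g"

text \<open>Only the values of \<open>\<phi>\<close> on the open ball and those of \<open>F\<close> (the potential $\Phi$) on the
  closed ball are constrained.\<close>

definition singular_homeomorphism :: "real \<Rightarrow> (real ^ 'n \<Rightarrow> real ^ 'n) \<Rightarrow> bool" where
  "singular_homeomorphism a \<phi> \<longleftrightarrow>
     (\<exists>\<psi>. homeomorphism (ball 0 a) UNIV \<phi> \<psi>) \<and> \<phi> 0 = 0 \<and>
     (\<exists>F. C1_potential_on (ball 0 a) F \<phi> \<and>
          continuous_on (cball 0 a) F \<and>
          strictly_convex_on (cball 0 a) F \<and>
          (\<forall>x\<in>cball 0 a. F x \<le> 0))"

text \<open>A multivalued operator is a set-valued function.\<close>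

definition operator_domain :: "('a \<Rightarrow> 'b set) \<Rightarrow> 'a set" where
  "operator_domain \<gamma> = {z. \<gamma> z \<noteq> {}}"

definition monotone_operator :: "('a::real_inner \<Rightarrow> 'a set) \<Rightarrow> bool" where
  "monotone_operator \<gamma> \<longleftrightarrow>
     (\<forall>x y. \<forall>v\<in>\<gamma> x. \<forall>w\<in>\<gamma> y. 0 \<le> (v - w) \<bullet> (x - y))"

definition maximal_monotone_operator :: "('a::real_inner \<Rightarrow> 'a set) \<Rightarrow> bool" where
  "maximal_monotone_operator \<gamma> \<longleftrightarrow> monotone_operator \<gamma> \<and>
     (\<forall>\<delta>. monotone_operator \<delta> \<and> (\<forall>x. \<gamma> x \<subseteq> \<delta> x) \<longrightarrow> \<delta> = \<gamma>)"

text \<open>Derivatives on the compact interval are taken within it, hence one-sided at the endpoints;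
  the values of a function outside the interval are irrelevant. For \<open>T > 0\<close> the derivative
  within the interval is unique wherever it exists.\<close>

definition deriv_Icc :: "real \<Rightarrow> (real \<Rightarrow> 'b::real_normed_vector) \<Rightarrow> real \<Rightarrow> 'b" where
  "deriv_Icc T u t = vector_derivative u (at t within {0..T})"

definition C1_Icc :: "real \<Rightarrow> (real \<Rightarrow> 'b::real_normed_vector) \<Rightarrow> bool" where
  "C1_Icc T u \<longleftrightarrow> (\<forall>t\<in>{0..T}. u differentiable (at t within {0..T})) \<and>
     continuous_on {0..T} (deriv_Icc T u)"

definition is_solution ::
  "real \<Rightarrow> real \<Rightarrow> (real ^ 'n \<Rightarrow> real ^ 'n)
    \<Rightarrow> ((real ^ 'n) \<times> (real ^ 'n) \<Rightarrow> ((real ^ 'n) \<times> (real ^ 'n)) set)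
    \<Rightarrow> (real \<Rightarrow> real ^ 'n) \<Rightarrow> (real \<Rightarrow> real ^ 'n) \<Rightarrow> bool" where
  "is_solution T a \<phi> \<gamma> h u \<longleftrightarrow>
     C1_Icc T u \<and>
     (\<forall>t\<in>{0..T}. norm (deriv_Icc T u t) < a) \<and>
     C1_Icc T (\<lambda>t. \<phi> (deriv_Icc T u t)) \<and>
     (u 0, u T) \<in> operator_domain \<gamma> \<and>
     (\<forall>t\<in>{0..T}. - deriv_Icc T (\<lambda>s. \<phi> (deriv_Icc T u s)) t + u t = h t) \<and>
     (\<phi> (deriv_Icc T u 0), - \<phi> (deriv_Icc T u T)) \<in> \<gamma> (u 0, u T)"

end

theory Submission
  imports Defs "HOL-Complex_Analysis.Great_Picard"
begin

text \<open>With $w = \phi(u')$ and $\psi = \phi^{-1}$ the problem becomes the system $u' = \psi(w)$,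
  $w' = u - h$ with $(w(0), -w(T)) \in \gamma(u(0), u(T))$, where $\psi$ is continuous, bounded,
  monotone and coercive. For prescribed $w(0) = p$ and $w(T) = -q$ it is solvable: in the equation
  with the delayed argument $w(t - \delta)$ the initial value $u(0)$ can be found by Brouwer's theorem,
  because $\psi$ is bounded, and $\delta \to 0$ by Arzela--Ascoli. For two solutions,
  $(w - z) \cdot (u - v)$ has derivative at least $|u - v|^2$. This yields uniqueness,
  both here and in the theorem, and shows that $S(p, q) = (u(0), u(T))$ is continuous. It remains to solve
  $S(p, q) \in \gamma^{-1}(p, q)$; this follows from the Debrunner--Flor lemma, where coercivity
  of $\psi$ gives the a priori bound, and from the maximality of $\gamma$.\<close>

subsection \<open>Prescribed values of $\phi(u')$ at the end points\<close>

text \<open>Substituting \<open>t * s\<close> for the integration variable moves the integral to the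
  fixed interval \<open>{0..1}\<close>, where continuity of parameter integrals yields joint
  continuity in the parameter and the upper limit.\<close>

lemma continuous_on_integral_upto:
  fixes f :: "'c::euclidean_space \<Rightarrow> real \<Rightarrow> 'a::euclidean_space"
  assumes f: "continuous_on (UNIV \<times> {0..}) (\<lambda>(c, s). f c s)"
  shows "continuous_on (UNIV \<times> {0..}) (\<lambda>(c, t). integral {0..t} (f c))"
proof -
  have eq: "integral {0..t} (f c) = t *\<^sub>R integral {0..1} (\<lambda>s. f c (t * s))" if "0 \<le> t" for c t
  proof (cases "t = 0")
    case False
    with that have "(\<lambda>x. x / t) ` {0..t} = {0..1}"
      using scaleR_image_atLeastAtMost[of "1/t" 0 t] by (simp add: mult.commute)
    with integral_stretch_real[of t 0 t "f c"] False that show ?thesis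
      by simp
  qed simp
  have "continuous_on (UNIV \<times> {0..}) (\<lambda>z. integral (cbox 0 1) (\<lambda>s. f (fst z) (snd z * s)))"
  proof (rule integral_continuous_on_param)
    show "continuous_on ((UNIV \<times> {0..}) \<times> cbox 0 1) (\<lambda>(z, s). f (fst z) (snd z * s))"
      unfolding case_prod_beta
      by (rule continuous_on_compose2[OF f, unfolded case_prod_beta,
            of _ "\<lambda>x. (fst (fst x), snd (fst x) * snd x)", simplified])
         (auto intro!: continuous_intros)
  qed
  then have "continuous_on (UNIV \<times> {0..})
      (\<lambda>z. snd z *\<^sub>R integral {0..1} (\<lambda>s. f (fst z) (snd z * s)))"
    by (auto intro!: continuous_intros)
  then show ?thesis
    by (rule continuous_on_eq) (auto simp: eq)
qed

lemma continuous_on_section: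
  assumes "continuous_on (UNIV \<times> S) (\<lambda>(c, t). f c t)" and "R \<subseteq> S"
  shows "continuous_on R (f c)"
  by (rule continuous_on_compose2[OF assms(1), of R "\<lambda>t. (c, t)", simplified])
     (use assms(2) in \<open>auto intro!: continuous_intros\<close>)

text \<open>With \<open>\<psi>\<close> merely continuous, solutions of the undelayed initial value
  problem need not be unique or depend continuously on \<open>c\<close>. The delay makes the system
  explicit, so it can be solved step by step with joint continuity in \<open>c\<close> and
  \<open>t\<close>, as the shooting argument requires. Clamping at 0 extends \<open>W c\<close> to
  negative times by its initial value \<open>p\<close>.\<close>

lemma delayed_system_solvable:
  fixes \<psi> :: "'a::euclidean_space \<Rightarrow> 'a" and h :: "real \<Rightarrow> 'a"
  assumes \<psi>: "continuous_on UNIV \<psi>" and h: "continuous_on {0..} h" and "0 < \<delta>" and "0 \<le> T"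
  obtains U W :: "'a \<Rightarrow> real \<Rightarrow> 'a" where
    "continuous_on (UNIV \<times> {0..}) (\<lambda>(c, t). W c t)"
    "\<And>c t. t \<in> {0..T} \<Longrightarrow> U c t = c + integral {0..t} (\<lambda>s. \<psi> (W c (max 0 (s - \<delta>))))"
    "\<And>c t. t \<in> {0..T} \<Longrightarrow> W c t = p + integral {0..t} (\<lambda>s. U c s - h s)"
    "\<And>c. continuous_on {0..} (U c)"
proof -
  define inn where "inn W c t = c + integral {0..t} (\<lambda>s. \<psi> (W c (max 0 (s - \<delta>))))"
    for W :: "'a \<Rightarrow> real \<Rightarrow> 'a" and c t
  define nxt where "nxt W c t = p + integral {0..t} (\<lambda>s. inn W c s - h s)"
    for W :: "'a \<Rightarrow> real \<Rightarrow> 'a" and c t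
  define V where "V k = (nxt ^^ k) (\<lambda>c t. p)" for k
  have V_Suc: "V (Suc k) = nxt (V k)" for k
    by (simp add: V_def)
  have cinn: "continuous_on (UNIV \<times> {0..}) (\<lambda>(c, t). inn W c t)"
    if W: "continuous_on (UNIV \<times> {0..}) (\<lambda>(c, t). W c t)" for W
  proof -
    have "continuous_on (UNIV \<times> {0..}) (\<lambda>(c, s). W c (max 0 (s - \<delta>)))"
      unfolding case_prod_beta
      by (rule continuous_on_compose2[OF W, unfolded case_prod_beta,
            of _ "\<lambda>x. (fst x, max 0 (snd x - \<delta>))", simplified])
         (auto intro!: continuous_intros)
    then have "continuous_on (UNIV \<times> {0..}) (\<lambda>(c, s). \<psi> (W c (max 0 (s - \<delta>))))"
      unfolding case_prod_beta by (rule continuous_on_compose2[OF \<psi>]) auto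
    from continuous_on_integral_upto[OF this] show ?thesis
      unfolding inn_def case_prod_beta by (auto intro!: continuous_intros)
  qed
  have cnxt: "continuous_on (UNIV \<times> {0..}) (\<lambda>(c, t). nxt W c t)"
    if W: "continuous_on (UNIV \<times> {0..}) (\<lambda>(c, t). W c t)" for W
  proof -
    have "continuous_on (UNIV \<times> {0..}) (\<lambda>x::'a \<times> real. h (snd x))"
      by (rule continuous_on_compose2[OF h]) (auto intro!: continuous_intros)
    with cinn[OF W] have "continuous_on (UNIV \<times> {0..}) (\<lambda>(c, s). inn W c s - h s)"
      unfolding case_prod_beta by (auto intro!: continuous_intros)
    from continuous_on_integral_upto[OF this] show ?thesis
      unfolding nxt_def case_prod_beta by (auto intro!: continuous_intros)
  qed
  have cV: "continuous_on (UNIV \<times> {0..}) (\<lambda>(c, t). V k c t)" for k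
    by (induction k) (simp add: V_def, simp add: V_Suc cnxt)
  \<comment> \<open>By the delay, each Picard iteration settles the solution on a further interval of length \<open>\<delta>\<close>.\<close>
  have stable: "V (Suc k) c t = V k c t" if "t \<in> {0..real k * \<delta>}" for k c t
    using that
  proof (induction k arbitrary: t)
    case 0
    then show ?case by (simp add: V_Suc nxt_def) (simp add: V_def)
  next
    case (Suc k)
    have "inn (V (Suc k)) c r = inn (V k) c r" if "r \<in> {0..t}" for r
      unfolding inn_def
    proof (intro arg_cong2[of _ _ _ _ "(+)"] refl integral_cong arg_cong[of _ _ \<psi>])
      fix s assume "s \<in> {0..r}"
      then show "V (Suc k) c (max 0 (s - \<delta>)) = V k c (max 0 (s - \<delta>))"
        using that Suc.prems \<open>0 < \<delta>\<close> by (intro Suc.IH) (auto simp: algebra_simps)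
    qed
    then show ?case
      unfolding V_Suc[of "Suc k"] V_Suc[of k] nxt_def[of "V k"] nxt_def[of "nxt (V k)"]
      by (intro arg_cong2[of _ _ _ _ "(+)"] refl integral_cong) (simp add: V_Suc)
  qed
  obtain n :: nat where n: "T < real n * \<delta>"
    using ex_less_of_nat_mult[OF \<open>0 < \<delta>\<close>] by blast
  show thesis
  proof (rule that[of "V n" "inn (V n)"])
    show "V n c t = p + integral {0..t} (\<lambda>s. inn (V n) c s - h s)" if "t \<in> {0..T}" for c t
      using stable[of t n c] that n by (auto simp: V_Suc nxt_def)
    show "continuous_on {0..} (inn (V n) c)" for c
      by (rule continuous_on_section[OF cinn[OF cV]]) auto
  qed (auto simp: inn_def cV)
qed

text \<open>Here \<open>w\<close> plays the role of $\phi(u')$ and \<open>\<psi>\<close> that of $\phi^{-1}$.\<close>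

definition hamiltonian_system ::
  "real \<Rightarrow> ('a::real_normed_vector \<Rightarrow> 'a) \<Rightarrow> (real \<Rightarrow> 'a) \<Rightarrow> (real \<Rightarrow> 'a) \<Rightarrow> (real \<Rightarrow> 'a) \<Rightarrow> bool" where
  "hamiltonian_system T \<psi> h u w \<longleftrightarrow> (\<forall>t\<in>{0..T}.
     (u has_vector_derivative \<psi> (w t)) (at t within {0..T}) \<and>
     (w has_vector_derivative u t - h t) (at t within {0..T}))"

lemma vector_derivative_bound_imp_lipschitz:
  fixes f :: "real \<Rightarrow> 'a::real_normed_vector"
  assumes "convex S"
    and "\<And>t. t \<in> S \<Longrightarrow> (f has_vector_derivative f' t) (at t within S)"
    and "\<And>t. t \<in> S \<Longrightarrow> norm (f' t) \<le> B" and "s \<in> S" "t \<in> S"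
  shows "norm (f s - f t) \<le> B * \<bar>s - t\<bar>"
proof -
  have "norm (f s - f t) \<le> B * norm (s - t)"
    using assms
    by (intro differentiable_bound[of S f "\<lambda>t x. x *\<^sub>R f' t"])
       (auto simp: has_vector_derivative_def onorm_scaleR_left onorm_id
        intro!: onorm_le simp: mult.commute mult_right_mono)
  then show ?thesis by simp
qed

lemma integral_equation_imp_has_vector_derivative:
  fixes g :: "real \<Rightarrow> 'a::banach"
  assumes "continuous_on {0..T} g" and eq: "\<And>t. t \<in> {0..T} \<Longrightarrow> f t = c + integral {0..t} g"
    and t: "t \<in> {0..T}"
  shows "(f has_vector_derivative g t) (at t within {0..T})"
proof -
  have "((\<lambda>t. c + integral {0..t} g) has_vector_derivative g t) (at t within {0..T})"
    using integral_has_vector_derivative[OF assms(1) t] by (auto intro!: derivative_eq_intros)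
  then show ?thesis
    by (rule has_vector_derivative_transform[OF t, rotated]) (simp add: eq)
qed

text \<open>Shooting: for fixed \<open>p\<close> the free parameter is the initial value
  \<open>c\<close> of \<open>u\<close>, and it has to be chosen so that \<open>w\<close> ends at
  \<open>q\<close>. The bound on \<open>u 0\<close> is independent of \<open>\<delta>\<close>; this
  is what gives compactness as the delay vanishes.\<close>

lemma delayed_boundary_problem_solvable:
  fixes \<psi> :: "'a::euclidean_space \<Rightarrow> 'a" and h :: "real \<Rightarrow> 'a"
  assumes \<psi>: "continuous_on UNIV \<psi>" and a: "\<And>x. norm (\<psi> x) \<le> a"
    and h: "continuous_on {0..} h" and H: "\<And>t. 0 \<le> t \<Longrightarrow> norm (h t) \<le> H"
    and "0 < \<delta>" and "0 < T"
  obtains u w where "continuous_on {0..} u" "continuous_on {0..} w"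
    "\<And>t. t \<in> {0..T} \<Longrightarrow> u t = u 0 + integral {0..t} (\<lambda>s. \<psi> (w (max 0 (s - \<delta>))))"
    "\<And>t. t \<in> {0..T} \<Longrightarrow> w t = p + integral {0..t} (\<lambda>s. u s - h s)"
    "w T = q" "norm (u 0) \<le> a * T + H + norm (q - p) / T"
proof -
  obtain U W where W: "continuous_on (UNIV \<times> {0..}) (\<lambda>(c, t). W c t)"
    and Ueq: "\<And>c t. t \<in> {0..T} \<Longrightarrow> U c t = c + integral {0..t} (\<lambda>s. \<psi> (W c (max 0 (s - \<delta>))))"
    and Weq: "\<And>c t. t \<in> {0..T} \<Longrightarrow> W c t = p + integral {0..t} (\<lambda>s. U c s - h s)"
    and U: "\<And>c. continuous_on {0..} (U c)"
    by (rule delayed_system_solvable[OF \<psi> h \<open>0 < \<delta>\<close> less_imp_le[OF \<open>0 < T\<close>], where p = p]) (rule that; assumption)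
  have a0: "0 \<le> a" using norm_ge_zero a by (rule order_trans)
  have H0: "0 \<le> H" using norm_ge_zero[of "h 0"] H[of 0] by linarith
  define M where "M = a * T + H + norm (q - p) / T"
  \<comment> \<open>\<open>W c T\<close> differs from \<open>T *\<^sub>R c\<close> by a bounded amount, so \<open>g\<close> is bounded; its fixed points solve \<open>W c T = q\<close>.\<close>
  define g where "g c = c - (W c T - q) /\<^sub>R T" for c
  have U_bound: "norm (U c s - c) \<le> a * T" if s: "s \<in> {0..T}" for c s
  proof -
    have "norm (integral {0..s} (\<lambda>s. \<psi> (W c (max 0 (s - \<delta>))))) \<le> a * (s - 0)"
    proof (rule integral_bound)
      have "continuous_on {0..s} (\<lambda>r. W c (max 0 (r - \<delta>)))"
        by (rule continuous_on_compose2[OF continuous_on_section[OF W order_refl, of c]])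
           (auto intro!: continuous_intros)
      then show "continuous_on {0..s} (\<lambda>s. \<psi> (W c (max 0 (s - \<delta>))))"
        by (rule continuous_on_compose2[OF \<psi>]) auto
    qed (use s a in auto)
    also have "\<dots> \<le> a * T" using s a0 by (intro mult_left_mono) auto
    finally show ?thesis using Ueq[OF s, of c] by simp
  qed
  have g_bound: "norm (g c) \<le> M" for c
  proof -
    have cont: "continuous_on {0..T} (\<lambda>s. U c s - h s)"
      by (intro continuous_intros continuous_on_subset[OF U] continuous_on_subset[OF h]) auto
    have "norm (integral {0..T} (\<lambda>s. (U c s - h s) - c)) \<le> (a * T + H) * (T - 0)"
    proof (rule integral_bound)
      show "continuous_on {0..T} (\<lambda>s. U c s - h s - c)" by (intro continuous_intros cont)
      show "norm (U c s - h s - c) \<le> a * T + H" if "s \<in> {0..T}" for s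
        using U_bound[OF that, of c] H[of s] that norm_triangle_ineq4[of "U c s - c" "h s"]
        by (simp add: algebra_simps)
    qed (use \<open>0 < T\<close> in auto)
    also have "integral {0..T} (\<lambda>s. (U c s - h s) - c) = W c T - p - T *\<^sub>R c"
      using \<open>0 < T\<close> Weq[of T c] by (subst integral_diff) (auto intro!: integrable_continuous_real cont)
    finally have *: "norm (W c T - p - T *\<^sub>R c) \<le> (a * T + H) * T" by simp
    have "g c = ((q - p) - (W c T - p - T *\<^sub>R c)) /\<^sub>R T"
      using \<open>0 < T\<close> by (simp add: g_def algebra_simps)
    also have "norm \<dots> \<le> (norm (q - p) + (a * T + H) * T) / T"
      using * norm_triangle_ineq4[of "q - p" "W c T - p - T *\<^sub>R c"] \<open>0 < T\<close>
      by (simp add: divide_inverse mult.commute mult_left_mono)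
    also have "\<dots> = M" using \<open>0 < T\<close> by (simp add: M_def field_simps)
    finally show ?thesis .
  qed
  have "0 \<le> M" using a0 H0 \<open>0 < T\<close> by (simp add: M_def)
  have g_cont: "continuous_on (cball 0 M) g"
    unfolding g_def
    by (intro continuous_intros continuous_on_compose2[OF W, unfolded case_prod_beta,
          of _ "\<lambda>c. (c, T)", simplified]) (use \<open>0 < T\<close> in auto)
  obtain c where c: "c \<in> cball 0 M" "g c = c"
    by (rule brouwer[OF compact_cball convex_cball _ g_cont]) (use \<open>0 \<le> M\<close> g_bound in auto)
  show thesis
  proof (rule that[of "U c" "W c"])
    show "U c t = U c 0 + integral {0..t} (\<lambda>s. \<psi> (W c (max 0 (s - \<delta>))))" if "t \<in> {0..T}" for t
      using Ueq[OF that, of c] Ueq[of 0 c] \<open>0 < T\<close> by simp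
    show "W c T = q" using c(2) \<open>0 < T\<close> by (simp add: g_def)
    show "norm (U c 0) \<le> a * T + H + norm (q - p) / T"
      using c(1) Ueq[of 0 c] \<open>0 < T\<close> by (simp add: M_def)
  qed (use U Weq continuous_on_section[OF W order_refl] in auto)
qed

text \<open>The bounds and Lipschitz constants of the delayed solutions do not depend on the delay,
  so a subsequence converges uniformly. Dominated convergence then carries both integral equations
  to the limit.\<close>

lemma hamiltonian_boundary_problem_solvable:
  fixes \<psi> :: "'a::euclidean_space \<Rightarrow> 'a" and h :: "real \<Rightarrow> 'a"
  assumes \<psi>: "continuous_on UNIV \<psi>" and a: "\<And>x. norm (\<psi> x) \<le> a"
    and h: "continuous_on {0..T} h" and "0 < T"
  shows "\<exists>u w. hamiltonian_system T \<psi> h u w \<and> w 0 = p \<and> w T = q"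
proof -
  \<comment> \<open>The delayed system lives on the whole half-line, so \<open>h\<close> is
    continued beyond \<open>T\<close> by its value \<open>h T\<close>.\<close>
  define k where "k t = h (min T t)" for t
  have k_eq: "k t = h t" if "t \<in> {0..T}" for t
    using that by (simp add: k_def min.absorb2)
  have k: "continuous_on {0..} k"
    unfolding k_def by (rule continuous_on_compose2[OF h]) (use \<open>0 < T\<close> in \<open>auto intro!: continuous_intros\<close>)
  obtain H where "\<forall>x\<in>h ` {0..T}. norm x \<le> H"
    using compact_imp_bounded[OF compact_continuous_image[OF h]] unfolding bounded_iff by auto
  then have H: "norm (k t) \<le> H" if "0 \<le> t" for t
    using that \<open>0 < T\<close> by (auto simp: k_def)
  have a0: "0 \<le> a" using norm_ge_zero a by (rule order_trans)
  have H0: "0 \<le> H" using norm_ge_zero[of "k 0"] H[of 0] by linarith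
  define M where "M = a * T + H + norm (q - p) / T"
  define \<delta> where "\<delta> n = inverse (real (Suc n))" for n
  have \<delta>_pos: "0 < \<delta> n" for n by (simp add: \<delta>_def)
  have \<delta>_lim: "\<delta> \<longlonglongrightarrow> 0"
    unfolding \<delta>_def by (rule LIMSEQ_inverse_real_of_nat)
  obtain u w where u: "\<And>n. continuous_on {0..} (u n)" and w: "\<And>n. continuous_on {0..} (w n)"
    and u_eq: "\<And>n t. t \<in> {0..T} \<Longrightarrow>
      u n t = u n 0 + integral {0..t} (\<lambda>s. \<psi> (w n (max 0 (s - \<delta> n))))"
    and w_eq: "\<And>n t. t \<in> {0..T} \<Longrightarrow> w n t = p + integral {0..t} (\<lambda>s. u n s - k s)"
    and wT: "\<And>n. w n T = q" and u0: "\<And>n. norm (u n 0) \<le> M"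
  proof -
    \<comment> \<open>Bundling all the conclusions in one predicate allows \<open>u n\<close> and
      \<open>w n\<close> to be chosen simultaneously for all \<open>n\<close>.\<close>
    define P where "P n u w \<longleftrightarrow> continuous_on {0..} u \<and> continuous_on {0..} w \<and>
      (\<forall>t\<in>{0..T}. u t = u 0 + integral {0..t} (\<lambda>s. \<psi> (w (max 0 (s - \<delta> n))))) \<and>
      (\<forall>t\<in>{0..T}. w t = p + integral {0..t} (\<lambda>s. u s - k s)) \<and> w T = q \<and> norm (u 0) \<le> M" for n u w
    have "\<exists>u w. P n u w" for n
      unfolding P_def M_def
      by (rule delayed_boundary_problem_solvable[OF \<psi> a k H \<delta>_pos[of n] \<open>0 < T\<close>, where p = p and q = q])
         (assumption, blast)
    then obtain u w where "\<And>n. P n (u n) (w n)" by metis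
    then show ?thesis using that[of u w] unfolding P_def by blast
  qed
  have cd: "continuous_on {0..} (\<lambda>s. \<psi> (w n (max 0 (s - \<delta> n))))" for n
  proof -
    have "continuous_on {0..} (\<lambda>s. w n (max 0 (s - \<delta> n)))"
      by (rule continuous_on_compose2[OF w]) (auto intro!: continuous_intros)
    then show ?thesis by (rule continuous_on_compose2[OF \<psi>]) auto
  qed
  have cuk: "continuous_on {0..} (\<lambda>s. u n s - k s)" for n
    by (intro continuous_intros u k)
  have u_lip: "norm (u n s - u n t) \<le> a * \<bar>s - t\<bar>" if "s \<in> {0..T}" "t \<in> {0..T}" for n s t
    by (rule vector_derivative_bound_imp_lipschitz[OF _
          integral_equation_imp_has_vector_derivative[OF continuous_on_subset[OF cd] u_eq]])
       (use a that in auto)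
  \<comment> \<open>\<open>L\<close> bounds the derivative \<open>u n t - k t\<close> of
    \<open>w n\<close>: the initial value contributes \<open>M\<close>, the growth of
    \<open>u n\<close> contributes \<open>a * T\<close>, and \<open>k\<close> contributes
    \<open>H\<close>.\<close>
  define L where "L = M + a * T + H"
  have u_bd: "norm (u n t) \<le> M + a * T" if "t \<in> {0..T}" for n t
  proof -
    have "norm (u n t - u n 0) \<le> a * \<bar>t - 0\<bar>" using that by (intro u_lip) auto
    also have "\<dots> \<le> a * T" using that a0 by (intro mult_left_mono) auto
    finally show ?thesis using u0[of n] norm_triangle_ineq2[of "u n t" "u n 0"] by linarith
  qed
  have "norm (u n t - k t) \<le> L" if "t \<in> {0..T}" for n t
    using u_bd[OF that, of n] H[of t] that norm_triangle_ineq4[of "u n t" "k t"] by (simp add: L_def)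
  then have w_lip: "norm (w n s - w n t) \<le> L * \<bar>s - t\<bar>" if "s \<in> {0..T}" "t \<in> {0..T}" for n s t
    by (intro vector_derivative_bound_imp_lipschitz[OF _
          integral_equation_imp_has_vector_derivative[OF continuous_on_subset[OF cuk] w_eq]])
       (use that in auto)
  have w0: "w n 0 = p" for n using w_eq[of 0 n] \<open>0 < T\<close> by simp
  have L0: "0 \<le> L" using a0 H0 \<open>0 < T\<close> by (simp add: L_def M_def)
  have w_bd: "norm (w n t) \<le> norm p + L * T" if "t \<in> {0..T}" for n t
  proof -
    have "norm (w n t - w n 0) \<le> L * \<bar>t - 0\<bar>" using that by (intro w_lip) auto
    also have "\<dots> \<le> L * T" using that L0 by (intro mult_left_mono) auto
    finally show ?thesis using w0[of n] norm_triangle_ineq2[of "w n t" "w n 0"] by simp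
  qed
  have lip: "norm ((u n s, w n s) - (u n t, w n t)) \<le> (a + L) * \<bar>s - t\<bar>"
    if "s \<in> {0..T}" "t \<in> {0..T}" for n s t
    using u_lip[OF that, of n] w_lip[OF that, of n] norm_Pair_le[of "u n s - u n t" "w n s - w n t"]
    by (simp add: algebra_simps)
  obtain z r where r: "strict_mono (r :: nat \<Rightarrow> nat)"
    and lim: "\<And>e. 0 < e \<Longrightarrow>
      \<exists>N. \<forall>n t. N \<le> n \<and> t \<in> {0..T} \<longrightarrow> norm ((u (r n) t, w (r n) t) - z t) < e"
    and z: "continuous_on {0..T} z"
  proof (rule Arzela_Ascoli[of "{0..T}" "\<lambda>n t. (u n t, w n t)" "M + a * T + (norm p + L * T)"])
    show "norm (u n t, w n t) \<le> M + a * T + (norm p + L * T)" if "t \<in> {0..T}" for n t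
      using norm_Pair_le[of "u n t" "w n t"] u_bd[OF that, of n] w_bd[OF that, of n] by linarith
    show "\<exists>d>0. \<forall>n y. y \<in> {0..T} \<and> norm (x - y) < d \<longrightarrow> norm ((u n x, w n x) - (u n y, w n y)) < e"
      if "x \<in> {0..T}" "0 < e" for x e
    proof (intro exI[of _ "e / (a + L + 1)"] conjI allI impI)
      show "0 < e / (a + L + 1)" using that a0 L0 by auto
      fix n y assume y: "y \<in> {0..T} \<and> norm (x - y) < e / (a + L + 1)"
      then have "norm ((u n x, w n x) - (u n y, w n y)) \<le> (a + L) * \<bar>x - y\<bar>"
        using lip that by blast
      also have "\<dots> \<le> (a + L + 1) * \<bar>x - y\<bar>" by (intro mult_right_mono) auto
      also have "\<dots> < e" using y a0 L0 by (simp add: pos_less_divide_eq mult.commute)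
      finally show "norm ((u n x, w n x) - (u n y, w n y)) < e" .
    qed
  qed auto
  define u' where "u' t = fst (z t)" for t
  define w' where "w' t = snd (z t)" for t
  have zlim: "(\<lambda>n. (u (r n) t, w (r n) t)) \<longlonglongrightarrow> z t" if "t \<in> {0..T}" for t
    using lim that by (force simp: LIMSEQ_iff)
  have ulim: "(\<lambda>n. u (r n) t) \<longlonglongrightarrow> u' t" and wlim: "(\<lambda>n. w (r n) t) \<longlonglongrightarrow> w' t" if "t \<in> {0..T}" for t
    using tendsto_fst[OF zlim[OF that]] tendsto_snd[OF zlim[OF that]] by (simp_all add: u'_def w'_def)
  have cu': "continuous_on {0..T} u'" and cw': "continuous_on {0..T} w'"
    using z unfolding u'_def w'_def by (auto intro!: continuous_intros)
  \<comment> \<open>The delay moves the argument by at most \<open>\<delta> (r n)\<close>, so the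
    common Lipschitz constant \<open>L\<close> makes its effect on \<open>w (r n)\<close> tend to
    0.\<close>
  have delay: "(\<lambda>n. \<psi> (w (r n) (max 0 (s - \<delta> (r n))))) \<longlonglongrightarrow> \<psi> (w' s)" if s: "s \<in> {0..T}" for s
  proof -
    have "(\<lambda>n. w (r n) (max 0 (s - \<delta> (r n))) - w (r n) s) \<longlonglongrightarrow> 0"
    proof (rule Lim_null_comparison)
      show "(\<lambda>n. L * \<delta> (r n)) \<longlonglongrightarrow> 0"
        using tendsto_mult_left[OF LIMSEQ_subseq_LIMSEQ[OF \<delta>_lim r], of L] by (simp add: o_def)
      show "\<forall>\<^sub>F n in sequentially. norm (w (r n) (max 0 (s - \<delta> (r n))) - w (r n) s) \<le> L * \<delta> (r n)"
      proof (rule always_eventually, rule allI)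
        fix n
        have "norm (w (r n) (max 0 (s - \<delta> (r n))) - w (r n) s) \<le> L * \<bar>max 0 (s - \<delta> (r n)) - s\<bar>"
          using s \<delta>_pos[of "r n"] by (intro w_lip) auto
        also have "\<dots> \<le> L * \<delta> (r n)"
          using L0 s \<delta>_pos[of "r n"] by (intro mult_left_mono) auto
        finally show "norm (w (r n) (max 0 (s - \<delta> (r n))) - w (r n) s) \<le> L * \<delta> (r n)" .
      qed
    qed
    from tendsto_add[OF this wlim[OF s]] have "(\<lambda>n. w (r n) (max 0 (s - \<delta> (r n)))) \<longlonglongrightarrow> w' s"
      by simp
    then show ?thesis
      by (rule continuous_on_tendsto_compose[OF \<psi>]) auto
  qed
  have u'_eq: "u' t = u' 0 + integral {0..t} (\<lambda>s. \<psi> (w' s))" if t: "t \<in> {0..T}" for t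
  proof (rule LIMSEQ_unique[OF ulim[OF t]])
    have "(\<lambda>n. integral {0..t} (\<lambda>s. \<psi> (w (r n) (max 0 (s - \<delta> (r n)))))) \<longlonglongrightarrow> integral {0..t} (\<lambda>s. \<psi> (w' s))"
      by (rule dominated_convergence[of _ _ "\<lambda>_. a"])
         (use t a delay in \<open>auto intro!: integrable_continuous_real continuous_on_subset[OF cd]\<close>)
    moreover have "(\<lambda>n. u (r n) 0) \<longlonglongrightarrow> u' 0" using \<open>0 < T\<close> by (intro ulim) auto
    ultimately show "(\<lambda>n. u (r n) t) \<longlonglongrightarrow> u' 0 + integral {0..t} (\<lambda>s. \<psi> (w' s))"
      by (subst u_eq[OF t]) (rule tendsto_add)
  qed
  have w'_eq: "w' t = p + integral {0..t} (\<lambda>s. u' s - k s)" if t: "t \<in> {0..T}" for t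
  proof (rule LIMSEQ_unique[OF wlim[OF t]])
    have "(\<lambda>n. integral {0..t} (\<lambda>s. u (r n) s - k s)) \<longlonglongrightarrow> integral {0..t} (\<lambda>s. u' s - k s)"
    proof (rule dominated_convergence[of _ _ "\<lambda>_. L"])
      show "(\<lambda>s. u (r n) s - k s) integrable_on {0..t}" for n
        by (auto intro!: integrable_continuous_real continuous_on_subset[OF cuk])
      show "norm (u (r n) s - k s) \<le> L" if "s \<in> {0..t}" for n s
        using \<open>\<And>t n. t \<in> {0..T} \<Longrightarrow> norm (u n t - k t) \<le> L\<close> that t by auto
      show "(\<lambda>n. u (r n) s - k s) \<longlonglongrightarrow> u' s - k s" if "s \<in> {0..t}" for s
        using that t by (intro tendsto_diff ulim tendsto_const) auto
    qed auto
    then show "(\<lambda>n. w (r n) t) \<longlonglongrightarrow> p + integral {0..t} (\<lambda>s. u' s - k s)"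
      by (subst w_eq[OF t]) (intro tendsto_add tendsto_const)
  qed
  have "hamiltonian_system T \<psi> h u' w'"
    unfolding hamiltonian_system_def
  proof (intro ballI conjI)
    fix t assume t: "t \<in> {0..T}"
    show "(u' has_vector_derivative \<psi> (w' t)) (at t within {0..T})"
      by (rule integral_equation_imp_has_vector_derivative[OF _ u'_eq t])
         (auto intro!: continuous_on_compose2[OF \<psi> cw'])
    show "(w' has_vector_derivative u' t - h t) (at t within {0..T})"
      unfolding k_eq[OF t, symmetric]
      by (rule integral_equation_imp_has_vector_derivative[OF _ w'_eq t])
         (auto intro!: continuous_intros cu' continuous_on_subset[OF k])
  qed
  moreover have "w' 0 = p" using w'_eq[of 0] \<open>0 < T\<close> by simp
  moreover have "w' T = q" using wlim[of T] \<open>0 < T\<close> by (simp add: wT LIMSEQ_const_iff)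
  ultimately show ?thesis by blast
qed

subsection \<open>Energy estimates\<close>

lemma mvt_lower_bound:
  fixes f :: "real \<Rightarrow> real"
  assumes "\<And>t. t \<in> S \<Longrightarrow> (f has_vector_derivative f' t) (at t within S)"
    and "{s..t} \<subseteq> S" "s \<le> t" and "\<And>x. x \<in> {s..t} \<Longrightarrow> K \<le> f' x"
  shows "K * (t - s) \<le> f t - f s"
proof (cases "s = t")
  case False
  with \<open>s \<le> t\<close> have "s < t" by simp
  have "(f has_vector_derivative f' x) (at x within {s..t})" if "s \<le> x" "x \<le> t" for x
    using assms(2) that by (intro has_vector_derivative_within_subset[OF assms(1)]) auto
  then have "\<exists>x\<in>{s<..<t}. f t - f s = (t - s) *\<^sub>R f' x"
    unfolding has_vector_derivative_def
    by (intro mvt_simple[OF \<open>s < t\<close>, of f "\<lambda>x y. y *\<^sub>R f' x"]) auto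
  then show ?thesis
    using assms(4) \<open>s < t\<close> by (auto simp: mult.commute intro!: mult_left_mono)
qed simp

text \<open>The forcing \<open>h\<close> cancels in the difference of two solutions, so the product
  rule leaves a square and a term of the kind controlled by monotonicity of
  \<open>\<psi>\<close>.\<close>

lemma energy_has_vector_derivative:
  fixes \<psi> :: "'a::real_inner \<Rightarrow> 'a"
  assumes "hamiltonian_system T \<psi> h u w" "hamiltonian_system T \<psi> h v z" and "t \<in> {0..T}"
  shows "((\<lambda>t. (w t - z t) \<bullet> (u t - v t)) has_vector_derivative
    (u t - v t) \<bullet> (u t - v t) + (\<psi> (w t) - \<psi> (z t)) \<bullet> (w t - z t)) (at t within {0..T})"
proof -
  have "((\<lambda>t. w t - z t) has_vector_derivative u t - v t) (at t within {0..T})"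
    using has_vector_derivative_diff[of w "u t - h t" "at t within {0..T}" z "v t - h t"] assms
    by (auto simp: hamiltonian_system_def)
  moreover have "((\<lambda>t. u t - v t) has_vector_derivative \<psi> (w t) - \<psi> (z t)) (at t within {0..T})"
    using assms by (auto simp: hamiltonian_system_def intro!: has_vector_derivative_diff)
  ultimately have "((\<lambda>t. (w t - z t) \<bullet> (u t - v t)) has_vector_derivative
      (w t - z t) \<bullet> (\<psi> (w t) - \<psi> (z t)) + (u t - v t) \<bullet> (u t - v t)) (at t within {0..T})"
    by (rule bounded_bilinear.has_vector_derivative[OF bounded_bilinear_inner])
  then show ?thesis by (simp add: inner_commute add.commute)
qed

lemma energy_growth:
  fixes \<psi> :: "'a::real_inner \<Rightarrow> 'a"
  assumes \<psi>: "\<And>x y. 0 \<le> (\<psi> x - \<psi> y) \<bullet> (x - y)"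
    and sys: "hamiltonian_system T \<psi> h u w" "hamiltonian_system T \<psi> h v z"
    and "0 \<le> s" "s \<le> t" "t \<le> T" and K: "\<And>x. x \<in> {s..t} \<Longrightarrow> K \<le> (norm (u x - v x))\<^sup>2"
  shows "K * (t - s) \<le> (w t - z t) \<bullet> (u t - v t) - (w s - z s) \<bullet> (u s - v s)"
proof (rule mvt_lower_bound[OF energy_has_vector_derivative[OF sys]])
  show "K \<le> (u x - v x) \<bullet> (u x - v x) + (\<psi> (w x) - \<psi> (z x)) \<bullet> (w x - z x)" if "x \<in> {s..t}" for x
    using K[OF that] \<psi>[of "w x" "z x"] by (simp add: power2_norm_eq_inner)
qed (use assms in auto)

text \<open>The energy is nondecreasing, so the assumed order of its end values forces it to be
  constant. Both nonnegative terms of its derivative then vanish. The assumption \<open>le\<close>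
  is the form in which a monotone boundary condition enters.\<close>

lemma hamiltonian_system_unique:
  fixes \<psi> :: "'a::real_inner \<Rightarrow> 'a"
  assumes \<psi>: "\<And>x y. 0 \<le> (\<psi> x - \<psi> y) \<bullet> (x - y)"
    and sys: "hamiltonian_system T \<psi> h u w" "hamiltonian_system T \<psi> h v z" and "0 < T"
    and le: "(w T - z T) \<bullet> (u T - v T) \<le> (w 0 - z 0) \<bullet> (u 0 - v 0)"
    and t: "t \<in> {0..T}"
  shows "u t = v t"
proof -
  define f where "f t = (w t - z t) \<bullet> (u t - v t)" for t
  have mono: "f s \<le> f t" if "0 \<le> s" "s \<le> t" "t \<le> T" for s t
    using energy_growth[OF \<psi> sys that, of 0] by (simp add: f_def)
  have "f s = f 0" if "s \<in> {0..T}" for s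
    using mono[of 0 s] mono[of s T] le that by (auto simp: f_def)
  then have "(f has_vector_derivative 0) (at t within {0..T})"
    by (intro has_vector_derivative_transform[OF t, of f "\<lambda>_. f 0"] has_vector_derivative_const)
  with energy_has_vector_derivative[OF sys t, folded f_def] t \<open>0 < T\<close>
  have "(u t - v t) \<bullet> (u t - v t) + (\<psi> (w t) - \<psi> (z t)) \<bullet> (w t - z t) = 0"
    by (intro vector_derivative_unique_within_closed_interval[of 0 T t f]) auto
  with \<psi>[of "w t" "z t"] have "(u t - v t) \<bullet> (u t - v t) = 0"
    by (smt (verit) inner_ge_zero)
  then show ?thesis by simp
qed

text \<open>If \<open>u\<close> and \<open>v\<close> were at distance \<open>A\<close> at least
  \<open>\<eta>\<close> at an end point, then by Lipschitz continuity they would stay at least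
  \<open>A / 2\<close> apart on an adjacent interval of length \<open>e\<close>, and the energy
  would grow by a fixed multiple of the square of \<open>A\<close>. But closeness of
  \<open>w\<close> and \<open>z\<close> at both ends allows only an increase of order
  \<open>d * A\<close>.\<close>

lemma hamiltonian_boundary_stable:
  fixes \<psi> :: "'a::real_inner \<Rightarrow> 'a"
  assumes \<psi>: "\<And>x y. 0 \<le> (\<psi> x - \<psi> y) \<bullet> (x - y)" and a: "\<And>x. norm (\<psi> x) \<le> a"
    and "0 < a" "0 < T" "0 < \<eta>"
  obtains d where "0 < d"
    "\<And>u w v z t. \<lbrakk>hamiltonian_system T \<psi> h u w; hamiltonian_system T \<psi> h v z;
       norm (w 0 - z 0) \<le> d; norm (w T - z T) \<le> d; t \<in> {0, T}\<rbrakk> \<Longrightarrow> norm (u t - v t) < \<eta>"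
proof -
  \<comment> \<open>As \<open>u - v\<close> has Lipschitz constant \<open>2 * a\<close>, it varies
    by at most \<open>\<eta> / 2\<close> over a length \<open>e\<close>. The factor \<open>q\<close>
    absorbs the constant in \<open>A + 2 * a * T \<le> A * q\<close>, and \<open>d\<close> is chosen
    so that \<open>8 * d * q = e * \<eta> / 2\<close>.\<close>
  define e where "e = min T (\<eta> / (4 * a))"
  define q where "q = 1 + 2 * a * T / \<eta>"
  define d where "d = e * \<eta> / (16 * q)"
  have e: "0 < e" "e \<le> T" using assms by (auto simp: e_def)
  have den: "0 < q" using assms by (simp add: q_def add_pos_pos)
  have "0 < d" using e den assms by (simp add: d_def)
  moreover have "norm (u t - v t) < \<eta>"
    if sys: "hamiltonian_system T \<psi> h u w" "hamiltonian_system T \<psi> h v z"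
      and d0: "norm (w 0 - z 0) \<le> d" and dT: "norm (w T - z T) \<le> d" and t: "t \<in> {0, T}"
    for u w v z t
  proof (rule ccontr)
    define A where "A = norm (u t - v t)"
    \<comment> \<open>The interval \<open>{l..l + e}\<close> is the one inside \<open>{0..T}\<close>
      that abuts the end point \<open>t\<close>.\<close>
    define l where "l = (if t = 0 then 0 else T - e)"
    have l: "0 \<le> l" "l + e \<le> T" "{l..l + e} \<subseteq> {0..T}" "t \<in> {l..l + e}"
      using e t by (auto simp: l_def)
    assume "\<not> norm (u t - v t) < \<eta>"
    then have A: "\<eta> \<le> A" by (simp add: A_def)
    have lip: "norm ((u x - v x) - (u y - v y)) \<le> 2 * a * \<bar>x - y\<bar>"
      if "x \<in> {0..T}" "y \<in> {0..T}" for x y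
    proof (rule vector_derivative_bound_imp_lipschitz[of "{0..T}" _ "\<lambda>t. \<psi> (w t) - \<psi> (z t)"])
      show "((\<lambda>t. u t - v t) has_vector_derivative \<psi> (w t) - \<psi> (z t)) (at t within {0..T})"
        if "t \<in> {0..T}" for t
        using sys that by (auto simp: hamiltonian_system_def intro!: has_vector_derivative_diff)
      show "norm (\<psi> (w t) - \<psi> (z t)) \<le> 2 * a" for t
        using norm_triangle_ineq4[of "\<psi> (w t)" "\<psi> (z t)"] a[of "w t"] a[of "z t"] by linarith
    qed (use that in auto)
    have far: "norm (u x - v x) \<le> A + 2 * a * T" if "x \<in> {0..T}" for x
    proof -
      have "norm ((u x - v x) - (u t - v t)) \<le> 2 * a * \<bar>x - t\<bar>"
        using that t \<open>0 < T\<close> by (intro lip) auto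
      also have "\<dots> \<le> 2 * a * T" using that t \<open>0 < a\<close> by (intro mult_left_mono) auto
      finally show ?thesis
        using norm_triangle_ineq2[of "u x - v x" "u t - v t"] by (simp add: A_def)
    qed
    have near: "(A / 2)\<^sup>2 \<le> (norm (u x - v x))\<^sup>2" if "x \<in> {l..l + e}" for x
    proof (rule power_mono)
      have "norm ((u t - v t) - (u x - v x)) \<le> 2 * a * \<bar>t - x\<bar>"
        using that t l \<open>0 < T\<close> by (intro lip) auto
      also have "\<dots> \<le> 2 * a * e" using that l \<open>0 < a\<close> by (intro mult_left_mono) auto
      also have "\<dots> \<le> 2 * a * (\<eta> / (4 * a))" using \<open>0 < a\<close> by (intro mult_left_mono) (auto simp: e_def)
      also have "\<dots> = \<eta> / 2" using \<open>0 < a\<close> by simp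
      also have "\<dots> \<le> A / 2" using A by simp
      finally show "A / 2 \<le> norm (u x - v x)"
        using norm_triangle_ineq2[of "u t - v t" "u x - v x"] by (simp add: A_def)
    qed (use A \<open>0 < \<eta>\<close> in auto)
    define f where "f t = (w t - z t) \<bullet> (u t - v t)" for t
    have "(A / 2)\<^sup>2 * (l + e - l) \<le> f (l + e) - f l"
      using l e near unfolding f_def by (intro energy_growth[OF \<psi> sys]) auto
    moreover have "f 0 \<le> f l" "f (l + e) \<le> f T"
      using energy_growth[OF \<psi> sys, of 0 l 0] energy_growth[OF \<psi> sys, of "l + e" T 0] l e
      by (auto simp: f_def)
    ultimately have "(A / 2)\<^sup>2 * e \<le> f T - f 0" by simp
    moreover have "f T \<le> d * (A + 2 * a * T)"
      unfolding f_def
      by (intro order.trans[OF norm_cauchy_schwarz] mult_mono dT far) (use \<open>0 < d\<close> \<open>0 < T\<close> in auto)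
    moreover have "- f 0 \<le> d * (A + 2 * a * T)"
      unfolding f_def inner_minus_left[symmetric]
      by (intro order.trans[OF norm_cauchy_schwarz] mult_mono far)
         (use \<open>0 < d\<close> \<open>0 < T\<close> d0 in \<open>auto simp: norm_minus_commute\<close>)
    ultimately have "A\<^sup>2 * e \<le> 8 * d * (A + 2 * a * T)"
      by (simp add: power_divide field_simps)
    also have "\<dots> \<le> 8 * d * (A * q)"
    proof (intro mult_left_mono)
      have "2 * a * T = \<eta> * (2 * a * T / \<eta>)" using \<open>0 < \<eta>\<close> by simp
      also have "\<dots> \<le> A * (2 * a * T / \<eta>)" using A assms by (intro mult_right_mono) auto
      finally show "A + 2 * a * T \<le> A * q" by (simp add: q_def algebra_simps)
    qed (use \<open>0 < d\<close> in auto)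
    also have "\<dots> = A * (e * \<eta> / 2)" using den by (simp add: d_def)
    finally have "A * e \<le> e * \<eta> / 2" using A \<open>0 < \<eta>\<close> by (simp add: power2_eq_square)
    moreover have "\<eta> / 2 < A" using A \<open>0 < \<eta>\<close> by simp
    then have "e * (\<eta> / 2) < e * A" using e by (intro mult_strict_left_mono)
    ultimately show False by (simp add: mult.commute)
  qed
  ultimately show thesis by (rule that)
qed

text \<open>By the mean value theorem the derivative of \<open>w t \<bullet> u t\<close> is
  nonpositive at some time \<open>s\<close>. There coercivity bounds both \<open>w s\<close> and
  \<open>u s\<close>, and the bounds on the derivatives spread this over the whole interval. For
  prescribed data \<open>z = (w 0, - w T)\<close>, the inequality between the end values is the
  condition \<open>F z \<bullet> z \<le> 0\<close> of the Debrunner--Flor lemma with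
  \<open>F z = - (u 0, u T)\<close>.\<close>

lemma hamiltonian_boundary_bounded:
  fixes \<psi> :: "'a::real_inner \<Rightarrow> 'a"
  assumes coercive: "\<And>x. r * norm x - C \<le> \<psi> x \<bullet> x" and "0 < r" and a: "\<And>x. norm (\<psi> x) \<le> a"
    and "0 < T" and H: "\<And>t. t \<in> {0..T} \<Longrightarrow> norm (h t) \<le> H"
  obtains R where "\<And>u w t. \<lbrakk>hamiltonian_system T \<psi> h u w; w T \<bullet> u T \<le> w 0 \<bullet> u 0; t \<in> {0..T}\<rbrakk>
    \<Longrightarrow> norm (w t) \<le> R"
proof -
  \<comment> \<open>\<open>D\<close> is what remains after half of the square of
    \<open>norm (u s)\<close> has absorbed \<open>h s \<bullet> u s\<close>. \<open>L\<close> bounds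
    the derivative of \<open>w\<close>; its \<open>1 / 2\<close> comes from estimating a norm by
    \<open>1 / 2\<close> plus half its square.\<close>
  define D where "D = C + H\<^sup>2 / 2"
  define L where "L = 1 / 2 + D + a * T + H"
  have "norm (w t) \<le> D / r + L * T"
    if sys: "hamiltonian_system T \<psi> h u w" and le: "w T \<bullet> u T \<le> w 0 \<bullet> u 0" and t: "t \<in> {0..T}" for u w t
  proof -
    define f' where "f' t = w t \<bullet> \<psi> (w t) + (u t - h t) \<bullet> u t" for t
    have f: "((\<lambda>t. w t \<bullet> u t) has_vector_derivative f' t) (at t within {0..T})"
      if "t \<in> {0..T}" for t
      unfolding f'_def using sys that
      by (intro bounded_bilinear.has_vector_derivative[OF bounded_bilinear_inner])
         (auto simp: hamiltonian_system_def)
    obtain s where s: "s \<in> {0<..<T}" "w T \<bullet> u T - w 0 \<bullet> u 0 = (T - 0) *\<^sub>R f' s"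
      using mvt_simple[of 0 T "\<lambda>t. w t \<bullet> u t" "\<lambda>x y. y *\<^sub>R f' x"] \<open>0 < T\<close> f
      by (auto simp: has_vector_derivative_def)
    with le have "T * f' s \<le> 0" by simp
    with \<open>0 < T\<close> have "f' s \<le> 0" by (simp add: mult_le_0_iff)
    moreover have "h s \<bullet> u s \<le> H\<^sup>2 / 2 + (norm (u s))\<^sup>2 / 2"
    proof -
      have "h s \<bullet> u s \<le> H * norm (u s)"
        by (intro order.trans[OF norm_cauchy_schwarz] mult_right_mono H) (use s in auto)
      also have "\<dots> \<le> H\<^sup>2 / 2 + (norm (u s))\<^sup>2 / 2"
        using sum_squares_bound[of H "norm (u s)"] by simp
      finally show ?thesis .
    qed
    ultimately have D: "r * norm (w s) + (norm (u s))\<^sup>2 / 2 \<le> D"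
      using coercive[of "w s"]
      by (simp add: f'_def D_def inner_diff_left power2_norm_eq_inner inner_commute[of "w s"])
    moreover have "norm (u s) \<le> 1 / 2 + (norm (u s))\<^sup>2 / 2"
      using sum_squares_bound[of 1 "norm (u s)"] by simp
    moreover have "0 \<le> r * norm (w s)" using \<open>0 < r\<close> by simp
    ultimately have us: "norm (u s) \<le> 1 / 2 + D" by linarith
    have "r * norm (w s) \<le> D" using D zero_le_power2[of "norm (u s)"] by linarith
    then have ws: "norm (w s) \<le> D / r" using \<open>0 < r\<close> by (simp add: field_simps)
    have a0: "0 \<le> a" using norm_ge_zero a by (rule order_trans)
    have u: "norm (u x) \<le> 1 / 2 + D + a * T" if "x \<in> {0..T}" for x
    proof -
      have "norm (u x - u s) \<le> a * \<bar>x - s\<bar>"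
        using sys that s a by (intro vector_derivative_bound_imp_lipschitz[of "{0..T}" u "\<lambda>t. \<psi> (w t)"])
          (auto simp: hamiltonian_system_def)
      also have "\<dots> \<le> a * T" using that s a0 by (intro mult_left_mono) auto
      finally show ?thesis using us norm_triangle_ineq2[of "u x" "u s"] by linarith
    qed
    have uh: "norm (u x - h x) \<le> L" if "x \<in> {0..T}" for x
      using u[OF that] H[OF that] norm_triangle_ineq4[of "u x" "h x"] by (simp add: L_def)
    have "0 \<le> L" using uh[of 0] order_trans[OF norm_ge_zero] \<open>0 < T\<close> by auto
    have "norm (w t - w s) \<le> L * \<bar>t - s\<bar>"
      using sys t s uh by (intro vector_derivative_bound_imp_lipschitz[of "{0..T}" w "\<lambda>t. u t - h t"])
        (auto simp: hamiltonian_system_def)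
    also have "\<dots> \<le> L * T" using t s \<open>0 \<le> L\<close> by (intro mult_left_mono) auto
    finally show ?thesis using ws norm_triangle_ineq2[of "w t" "w s"] by linarith
  qed
  then show thesis by (rule that)
qed

subsection \<open>The Debrunner--Flor lemma\<close>

text \<open>The conclusion says that \<open>(z, - F z)\<close> is monotonically related to every
  pair of the finite monotone set \<open>D\<close>. Finiteness makes the convex hull of the first
  components compact, so Brouwer's theorem applies there.\<close>

lemma debrunner_flor_finite:
  fixes F :: "'b::euclidean_space \<Rightarrow> 'b"
  assumes "finite D" "D \<noteq> {}"
    and mono: "\<And>x y x' y'. \<lbrakk>(x, y) \<in> D; (x', y') \<in> D\<rbrakk> \<Longrightarrow> 0 \<le> (y - y') \<bullet> (x - x')"
    and F: "continuous_on UNIV F"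
  shows "\<exists>z. \<forall>(x, y)\<in>D. 0 \<le> (y + F z) \<bullet> (x - z)"
proof (rule ccontr)
  define e where "e d z = (snd d + F z) \<bullet> (fst d - z)" for d :: "'b \<times> 'b" and z
  \<comment> \<open>If no point works, the weights \<open>\<beta>\<close> form a partition of unity up to normalization, and a fixed
    point of the weighted mean \<open>P\<close> of the first components contradicts monotonicity.\<close>
  define \<beta> where "\<beta> d z = max 0 (- e d z)" for d z
  define s where "s z = (\<Sum>d\<in>D. \<beta> d z)" for z
  define P where "P z = (\<Sum>d\<in>D. (\<beta> d z / s z) *\<^sub>R fst d)" for z
  assume "\<not> ?thesis"
  then have neg: "\<exists>d\<in>D. e d z < 0" for z
    by (force simp: e_def not_le)
  have \<beta>0: "0 \<le> \<beta> d z" for d z by (simp add: \<beta>_def)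
  have s: "0 < s z" for z
  proof -
    obtain d where "d \<in> D" "e d z < 0" using neg by blast
    then show ?thesis unfolding s_def using \<open>finite D\<close> \<beta>0
      by (intro sum_pos2[of D d]) (auto simp: \<beta>_def)
  qed
  have sum1: "(\<Sum>d\<in>D. \<beta> d z / s z) = 1" for z
    using s[of z] by (simp add: s_def flip: sum_divide_distrib)
  have \<beta>_cont: "continuous_on UNIV (\<beta> d)" for d
    unfolding \<beta>_def e_def by (intro continuous_intros F)
  have P_cont: "continuous_on (convex hull (fst ` D)) P"
  proof (rule continuous_on_subset)
    have "s z \<noteq> 0" for z using s[of z] by simp
    then show "continuous_on UNIV P"
      unfolding P_def s_def by (auto intro!: continuous_intros \<beta>_cont)
  qed simp
  obtain z where z: "P z = z"
  proof (rule brouwer[OF _ convex_convex_hull _ P_cont])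
    show "compact (convex hull (fst ` D))"
      using \<open>finite D\<close> by (intro finite_imp_compact_convex_hull) simp
    show "convex hull (fst ` D) \<noteq> {}" using \<open>D \<noteq> {}\<close> by simp
    show "P \<in> convex hull (fst ` D) \<rightarrow> convex hull (fst ` D)"
    proof
      fix z
      show "P z \<in> convex hull (fst ` D)"
        unfolding P_def
        by (rule convex_sum[OF \<open>finite D\<close> convex_convex_hull sum1])
           (use \<beta>0 s[of z] in \<open>auto intro!: hull_inc less_imp_le\<close>)
    qed
  qed
  define m where "m d = \<beta> d z / s z" for d
  have m0: "0 \<le> m d" for d using \<beta>0 s[of z] by (simp add: m_def)
  have msum: "(\<Sum>d\<in>D. m d) = 1" using sum1 by (simp add: m_def)
  have mz: "(\<Sum>d\<in>D. m d *\<^sub>R fst d) = z" using z by (simp add: P_def m_def)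
  have mdiff: "(\<Sum>d\<in>D. m d *\<^sub>R (c - fst d)) = c - z" for c
    by (simp add: scaleR_diff_right sum_subtractf mz msum flip: scaleR_sum_left)
  \<comment> \<open>A weight \<open>m d\<close> is positive exactly when \<open>e d z\<close> is
    negative, and this happens for at least one \<open>d\<close>.\<close>
  have "(\<Sum>d\<in>D. m d * e d z) < (\<Sum>d\<in>D. 0)"
  proof (rule sum_strict_mono_ex1[OF \<open>finite D\<close>])
    show "\<forall>d\<in>D. m d * e d z \<le> 0"
      using s[of z] by (auto simp: m_def \<beta>_def max_def mult_le_0_iff)
    show "\<exists>d\<in>D. m d * e d z < 0"
    proof -
      obtain d where d: "d \<in> D" "e d z < 0" using neg by blast
      with s[of z] have "0 < m d" by (auto simp: m_def \<beta>_def max_def intro: divide_neg_pos)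
      with d show ?thesis by (auto intro: mult_pos_neg)
    qed
  qed
  \<comment> \<open>The contribution of \<open>F z\<close> is paired with the weighted mean of
    \<open>z - fst d\<close>, which vanishes because \<open>z\<close> is itself the weighted
    mean.\<close>
  moreover have "(\<Sum>d\<in>D. m d * e d z) = (\<Sum>d\<in>D. m d * (snd d \<bullet> (fst d - z)))"
  proof -
    have "(\<Sum>d\<in>D. m d * e d z) =
        (\<Sum>d\<in>D. m d * (snd d \<bullet> (fst d - z))) - F z \<bullet> (\<Sum>d\<in>D. m d *\<^sub>R (z - fst d))"
      by (simp add: e_def inner_sum_right inner_add_left inner_diff_right algebra_simps
          flip: sum_subtractf sum.distrib)
    then show ?thesis by (simp add: mdiff)
  qed
  moreover have "0 \<le> (\<Sum>d\<in>D. m d * (snd d \<bullet> (fst d - z)))"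
  proof -
    \<comment> \<open>Writing \<open>z\<close> as the weighted mean turns the sum into a double sum
      over pairs. Adding the same double sum with its indices exchanged leaves only monotonicity
      terms with nonnegative weights.\<close>
    define A where "A = (\<Sum>d\<in>D. \<Sum>c\<in>D. m d * m c * (snd d \<bullet> (fst d - fst c)))"
    have "A = (\<Sum>d\<in>D. m d * (snd d \<bullet> (fst d - z)))"
      by (simp add: A_def flip: mdiff) (simp add: inner_sum_right sum_distrib_left mult.assoc)
    moreover have swap: "A = (\<Sum>d\<in>D. \<Sum>c\<in>D. m d * m c * (snd c \<bullet> (fst c - fst d)))" (is "_ = ?B")
      unfolding A_def by (subst sum.swap) (simp add: mult.commute)
    have "A + ?B = (\<Sum>d\<in>D. \<Sum>c\<in>D. m d * m c * ((snd d - snd c) \<bullet> (fst d - fst c)))"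
      by (simp add: A_def inner_diff_left inner_diff_right algebra_simps flip: sum.distrib)
    with swap have "A + A = (\<Sum>d\<in>D. \<Sum>c\<in>D. m d * m c * ((snd d - snd c) \<bullet> (fst d - fst c)))"
      by simp
    moreover have "0 \<le> \<dots>"
      using mono m0 by (intro sum_nonneg mult_nonneg_nonneg) auto
    ultimately show ?thesis by linarith
  qed
  ultimately show False by simp
qed

text \<open>Each pair of \<open>G\<close> defines a closed set of admissible \<open>z\<close>. The
  finite case and the a priori bound show that finitely many of these sets meet inside
  \<open>cball 0 R\<close>, so compactness gives a common point.\<close>

lemma debrunner_flor:
  fixes F :: "'b::euclidean_space \<Rightarrow> 'b"
  assumes mono: "\<And>x y x' y'. \<lbrakk>(x, y) \<in> G; (x', y') \<in> G\<rbrakk> \<Longrightarrow> 0 \<le> (y - y') \<bullet> (x - x')"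
    and "0 \<in> G" and F: "continuous_on UNIV F" and R: "\<And>z. F z \<bullet> z \<le> 0 \<Longrightarrow> norm z \<le> R"
  obtains z where "\<And>x y. (x, y) \<in> G \<Longrightarrow> 0 \<le> (y + F z) \<bullet> (x - z)"
proof -
  define C where "C d = {z. 0 \<le> (snd d + F z) \<bullet> (fst d - z)}" for d :: "'b \<times> 'b"
  have "cball 0 R \<inter> (\<Inter>d\<in>G. C d) \<noteq> {}"
  proof (rule compact_imp_fip_image)
    show "closed (C d)" for d
      unfolding C_def by (intro closed_Collect_le continuous_intros F)
    fix D assume D: "finite D" "D \<subseteq> G"
    \<comment> \<open>Including the pair 0 among the constraints yields
      \<open>F z \<bullet> z \<le> 0\<close>, the premise of the bound \<open>R\<close>.\<close>
    have "insert 0 D \<subseteq> G" using D \<open>0 \<in> G\<close> by simp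
    then have "\<exists>z. \<forall>(x, y)\<in>insert 0 D. 0 \<le> (y + F z) \<bullet> (x - z)"
      using D(1) by (intro debrunner_flor_finite[OF _ _ mono F]) (auto simp: subset_iff)
    then obtain z where z: "\<And>x y. (x, y) \<in> insert 0 D \<Longrightarrow> 0 \<le> (y + F z) \<bullet> (x - z)"
      by blast
    have "F z \<bullet> z \<le> 0" using z[of 0 0] by (simp add: zero_prod_def)
    then have "z \<in> cball 0 R \<inter> (\<Inter>d\<in>D. C d)"
      using R[of z] z by (auto simp: C_def)
    then show "cball 0 R \<inter> (\<Inter>d\<in>D. C d) \<noteq> {}" by blast
  qed simp
  then show thesis using that by (force simp: C_def)
qed

subsection \<open>The inclusion for the boundary values\<close>

lemma strictly_convex_on_imp_convex_on: "strictly_convex_on S f \<Longrightarrow> convex_on S f"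
  by (rule convex_onI)
     (metis strictly_convex_on_def less_imp_le order_refl scaleR_left_diff_distrib scaleR_one
       add.commute diff_add_cancel left_diff_distrib mult_1, simp add: strictly_convex_on_def)

text \<open>Along the segment from \<open>x\<close> to \<open>y\<close>, convexity bounds the
  difference quotients at \<open>x\<close> by \<open>F y - F x\<close>; their limit from the right
  is the directional derivative.\<close>

lemma convex_on_gradient_inequality:
  fixes F :: "'a::real_inner \<Rightarrow> real"
  assumes conv: "convex_on S F" and xy: "x \<in> S" "y \<in> S" and "GDERIV F x :> g"
  shows "g \<bullet> (y - x) \<le> F y - F x"
proof -
  define f where "f t = F (x + t *\<^sub>R (y - x))" for t
  have "(F has_derivative (\<lambda>h. h \<bullet> g)) (at (x + 0 *\<^sub>R (y - x)))"
    using assms(4) by (simp add: gderiv_def)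
  then have "(f has_derivative (\<lambda>t. (t *\<^sub>R (y - x)) \<bullet> g)) (at 0)"
    unfolding f_def by (rule has_derivative_compose[rotated]) (auto intro!: derivative_eq_intros)
  then have "(f has_field_derivative g \<bullet> (y - x)) (at 0)"
    unfolding has_field_derivative_def by (rule has_derivative_eq_rhs) (auto simp: inner_commute mult.commute)
  then have lim: "((\<lambda>t. (f t - f 0) / t) \<longlongrightarrow> g \<bullet> (y - x)) (at_right 0)"
    by (auto simp: has_field_derivative_iff intro: tendsto_mono[OF at_le])
  have "(f t - f 0) / t \<le> F y - F x" if "0 < t" "t < 1" for t
  proof -
    have "x + t *\<^sub>R (y - x) = (1 - t) *\<^sub>R x + t *\<^sub>R y" by (simp add: algebra_simps)
    then have "f t \<le> (1 - t) * F x + t * F y"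
      using convex_onD[OF conv, of t x y] that xy by (simp add: f_def)
    then show ?thesis using that by (simp add: f_def field_simps)
  qed
  then have "\<forall>\<^sub>F t in at_right 0. (f t - f 0) / t \<le> F y - F x"
    unfolding eventually_at_right_field by (auto intro!: exI[of _ 1])
  then show ?thesis
    by (rule tendsto_upperbound[OF lim]) simp
qed

lemma convex_on_gradient_monotone:
  fixes F :: "'a::real_inner \<Rightarrow> real"
  assumes "convex_on S F" "x \<in> S" "y \<in> S" "GDERIV F x :> g" "GDERIV F y :> k"
  shows "0 \<le> (g - k) \<bullet> (x - y)"
  using convex_on_gradient_inequality[OF assms(1-4)] convex_on_gradient_inequality[OF assms(1,3,2,5)]
  by (simp add: inner_diff_left inner_diff_right)

text \<open>Monotonicity is tested at \<open>\<psi> w\<close> and the point of norm \<open>r\<close>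
  in the direction of \<open>w\<close>. On the ball of radius \<open>r\<close> the values of
  \<open>\<phi>\<close> are bounded by compactness, and the arguments are bounded by
  \<open>a\<close>, so the error is a constant.\<close>

lemma monotone_inverse_coercive:
  fixes \<phi> :: "'a::euclidean_space \<Rightarrow> 'a"
  assumes mono: "\<And>x y. \<lbrakk>x \<in> ball 0 a; y \<in> ball 0 a\<rbrakk> \<Longrightarrow> 0 \<le> (\<phi> x - \<phi> y) \<bullet> (x - y)"
    and \<phi>: "continuous_on (ball 0 a) \<phi>"
    and \<psi>: "\<And>w. \<psi> w \<in> ball 0 a" "\<And>w. \<phi> (\<psi> w) = w" and r: "0 < r" "r < a"
  obtains C where "\<And>w. r * norm w - C \<le> \<psi> w \<bullet> w"
proof -
  have "compact (\<phi> ` cball 0 r)"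
    using r by (intro compact_continuous_image continuous_on_subset[OF \<phi>]) auto
  then obtain B where B: "\<And>x. norm x \<le> r \<Longrightarrow> norm (\<phi> x) \<le> B"
    by (metis bounded_iff compact_imp_bounded image_eqI mem_cball_0)
  have "r * norm w - B * (a + r) \<le> \<psi> w \<bullet> w" for w
  proof -
    define E where "E = r *\<^sub>R sgn w"
    have E: "norm E \<le> r" using r by (simp add: E_def norm_sgn)
    have wE: "w \<bullet> E = r * norm w"
      by (cases "w = 0") (simp_all add: E_def sgn_div_norm dot_square_norm power2_eq_square)
    have "norm (\<psi> w - E) \<le> a + r"
      using norm_triangle_ineq4[of "\<psi> w" E] \<psi>(1)[of w] E by simp
    then have "norm (\<phi> E) * norm (\<psi> w - E) \<le> B * (a + r)"
      using B[OF E] order_trans[OF norm_ge_zero B[OF E]] by (intro mult_mono) auto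
    then have "- (B * (a + r)) \<le> \<phi> E \<bullet> (\<psi> w - E)"
      using norm_cauchy_schwarz[of "- \<phi> E" "\<psi> w - E"] by simp
    moreover have "0 \<le> (w - \<phi> E) \<bullet> (\<psi> w - E)"
      using mono[of "\<psi> w" E] \<psi> E r by simp
    ultimately show ?thesis
      using wE by (simp add: inner_diff_left inner_diff_right inner_commute)
  qed
  then show thesis by (rule that)
qed

text \<open>Adding the single value \<open>y\<close> at \<open>z\<close> keeps the operator
  monotone, so by maximality the value was already there.\<close>

lemma maximal_monotone_operatorD:
  assumes "maximal_monotone_operator \<gamma>" and y: "\<And>x v. v \<in> \<gamma> x \<Longrightarrow> 0 \<le> (v - y) \<bullet> (x - z)"
  shows "y \<in> \<gamma> z"
proof -
  define \<delta> where "\<delta> = \<gamma>(z := insert y (\<gamma> z))"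
  have mono: "0 \<le> (v - w) \<bullet> (x - x')" if "v \<in> \<gamma> x" "w \<in> \<gamma> x'" for v w x x'
    using assms(1) that by (auto simp: maximal_monotone_operator_def monotone_operator_def)
  have y': "0 \<le> (y - v) \<bullet> (z - x)" if "v \<in> \<gamma> x" for x v
    using y[OF that] by (simp add: inner_diff_left inner_diff_right)
  have "monotone_operator \<delta>"
    using mono y y' by (auto simp: monotone_operator_def \<delta>_def)
  then have "\<delta> = \<gamma>"
    using assms(1) by (auto simp: maximal_monotone_operator_def \<delta>_def)
  then show ?thesis by (metis \<delta>_def fun_upd_same insertI1)
qed

lemma hamiltonian_inclusion_solvable:
  fixes \<psi> :: "'a::euclidean_space \<Rightarrow> 'a" and \<gamma> :: "'a \<times> 'a \<Rightarrow> ('a \<times> 'a) set"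
  assumes \<psi>: "continuous_on UNIV \<psi>" "\<And>x y. 0 \<le> (\<psi> x - \<psi> y) \<bullet> (x - y)"
    and coercive: "\<And>x. r * norm x - C \<le> \<psi> x \<bullet> x" "0 < r"
    and a: "\<And>x. norm (\<psi> x) \<le> a" "0 < a"
    and h: "continuous_on {0..T} h" and "0 < T"
    and \<gamma>: "maximal_monotone_operator \<gamma>" "0 \<in> \<gamma> 0"
  obtains u w where "hamiltonian_system T \<psi> h u w" "(w 0, - w T) \<in> \<gamma> (u 0, u T)"
proof -
  have "\<forall>z. \<exists>u w. hamiltonian_system T \<psi> h u w \<and> w 0 = fst z \<and> w T = - snd z"
    using hamiltonian_boundary_problem_solvable[OF \<psi>(1) a(1) h \<open>0 < T\<close>] by blast
  then obtain u w where sys: "\<And>z. hamiltonian_system T \<psi> h (u z) (w z)"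
    and w0: "\<And>z. w z 0 = fst z" and wT: "\<And>z. w z T = - snd z"
    by metis
  \<comment> \<open>For \<open>z = (p, q)\<close> this is $-S(p, q)$; the minus sign in \<open>wT\<close> makes it monotone.\<close>
  define F where "F z = - (u z 0, u z T)" for z
  obtain H where "\<forall>x\<in>h ` {0..T}. norm x \<le> H"
    using compact_imp_bounded[OF compact_continuous_image[OF h]] unfolding bounded_iff by auto
  then have H: "\<And>t. t \<in> {0..T} \<Longrightarrow> norm (h t) \<le> H" by blast
  obtain R where R: "\<And>u w t. \<lbrakk>hamiltonian_system T \<psi> h u w; w T \<bullet> u T \<le> w 0 \<bullet> u 0; t \<in> {0..T}\<rbrakk>
      \<Longrightarrow> norm (w t) \<le> R"
    by (rule hamiltonian_boundary_bounded[OF coercive a(1) \<open>0 < T\<close> H]) blast+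
  have bound: "norm z \<le> R + R" if "F z \<bullet> z \<le> 0" for z
  proof -
    have "w z T \<bullet> u z T \<le> w z 0 \<bullet> u z 0"
      using that by (cases z) (simp add: F_def w0 wT inner_commute)
    from R[OF sys this, of 0] R[OF sys this, of T] \<open>0 < T\<close>
    have "norm (fst z) \<le> R" "norm (snd z) \<le> R" by (simp_all add: w0 wT)
    then show ?thesis using norm_Pair_le[of "fst z" "snd z"] by simp
  qed
  have cont: "continuous_on UNIV F"
    unfolding continuous_on_iff
  proof (intro ballI allI impI)
    fix z and \<epsilon> :: real assume "0 < \<epsilon>"
    then have "0 < \<epsilon> / 2" by simp
    obtain d where "0 < d" and d: "\<And>u w v z t. \<lbrakk>hamiltonian_system T \<psi> h u w;
        hamiltonian_system T \<psi> h v z; norm (w 0 - z 0) \<le> d; norm (w T - z T) \<le> d; t \<in> {0, T}\<rbrakk>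
        \<Longrightarrow> norm (u t - v t) < \<epsilon> / 2"
      by (rule hamiltonian_boundary_stable[OF \<psi>(2) a \<open>0 < T\<close> \<open>0 < \<epsilon> / 2\<close>]) blast+
    show "\<exists>d>0. \<forall>z'\<in>UNIV. dist z' z < d \<longrightarrow> dist (F z') (F z) < \<epsilon>"
    proof (intro exI[of _ d] conjI ballI impI \<open>0 < d\<close>)
      fix z' assume "dist z' z < d"
      then have "norm (w z' 0 - w z 0) \<le> d" "norm (w z' T - w z T) \<le> d"
        using dist_fst_le[of z' z] dist_snd_le[of z' z]
        by (auto simp: w0 wT dist_norm norm_minus_commute)
      then have "norm (u z' 0 - u z 0) < \<epsilon> / 2" "norm (u z' T - u z T) < \<epsilon> / 2"
        using d[OF sys sys] by auto
      then have "norm ((u z' 0, u z' T) - (u z 0, u z T)) < \<epsilon>"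
        using norm_Pair_le[of "u z' 0 - u z 0" "u z' T - u z T"] by simp
      then show "dist (F z') (F z) < \<epsilon>"
        unfolding F_def dist_minus unfolding dist_norm .
    qed
  qed
  \<comment> \<open>The unknown \<open>z\<close> is to be a value of \<open>\<gamma>\<close>, not an
    argument, so the Debrunner--Flor lemma is applied to the graph of the inverse of
    \<open>\<gamma>\<close>.\<close>
  define G where "G = {(x, y). x \<in> \<gamma> y}"
  have "0 \<le> (y - y') \<bullet> (x - x')" if "(x, y) \<in> G" "(x', y') \<in> G" for x y x' y'
  proof -
    have "x \<in> \<gamma> y" "x' \<in> \<gamma> y'" using that by (simp_all add: G_def)
    then have "0 \<le> (x - x') \<bullet> (y - y')"
      using \<gamma>(1) unfolding maximal_monotone_operator_def monotone_operator_def by blast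
    then show ?thesis by (subst inner_commute)
  qed
  moreover have "0 \<in> G" using \<gamma>(2) by (simp add: G_def zero_prod_def)
  ultimately obtain z where z: "\<And>x y. (x, y) \<in> G \<Longrightarrow> 0 \<le> (y + F z) \<bullet> (x - z)"
    using debrunner_flor[OF _ _ cont bound] by blast
  \<comment> \<open>Since \<open>- F z\<close> is \<open>(u z 0, u z T)\<close>, the choice of
    \<open>z\<close> says that this point with value \<open>z\<close> is monotonically related to
    the whole graph of \<open>\<gamma>\<close>.\<close>
  have "z \<in> \<gamma> (u z 0, u z T)"
  proof (rule maximal_monotone_operatorD[OF \<gamma>(1)])
    fix x v assume "v \<in> \<gamma> x"
    then show "0 \<le> (v - z) \<bullet> (x - (u z 0, u z T))"
      using z[of v x] by (simp add: G_def F_def inner_commute del: uminus_Pair)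
  qed
  then show thesis using that[OF sys, of z] by (simp add: w0 wT)
qed

section \<open>Translation between the boundary value problem and the first-order system\<close>

lemma is_solution_imp_hamiltonian_system:
  assumes sol: "is_solution T a \<phi> \<gamma> h u" and \<psi>: "\<And>x. norm x < a \<Longrightarrow> \<psi> (\<phi> x) = x"
  shows "hamiltonian_system T \<psi> h u (\<lambda>t. \<phi> (deriv_Icc T u t))"
  unfolding hamiltonian_system_def
proof (intro ballI conjI)
  fix t assume t: "t \<in> {0..T}"
  show "(u has_vector_derivative \<psi> (\<phi> (deriv_Icc T u t))) (at t within {0..T})"
    using sol t by (simp add: is_solution_def C1_Icc_def \<psi> vector_derivative_works deriv_Icc_def)
  have "((\<lambda>t. \<phi> (deriv_Icc T u t)) has_vector_derivative
      deriv_Icc T (\<lambda>t. \<phi> (deriv_Icc T u t)) t) (at t within {0..T})"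
    using sol t unfolding is_solution_def C1_Icc_def
    by (subst (2) deriv_Icc_def) (auto simp flip: vector_derivative_works)
  moreover have "deriv_Icc T (\<lambda>t. \<phi> (deriv_Icc T u t)) t = u t - h t"
    using sol t by (auto simp: is_solution_def algebra_simps)
  ultimately show "((\<lambda>t. \<phi> (deriv_Icc T u t)) has_vector_derivative u t - h t) (at t within {0..T})"
    by simp
qed

lemma deriv_Icc_eq:
  fixes u :: "real \<Rightarrow> 'a::euclidean_space"
  assumes "0 < T" "t \<in> {0..T}" "(u has_vector_derivative u') (at t within {0..T})"
  shows "deriv_Icc T u t = u'"
  unfolding deriv_Icc_def using assms by (rule vector_derivative_within_closed_interval)

lemma C1_IccI:
  fixes u :: "real \<Rightarrow> 'a::euclidean_space"
  assumes "0 < T" and u: "\<And>t. t \<in> {0..T} \<Longrightarrow> (u has_vector_derivative u' t) (at t within {0..T})"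
    and "continuous_on {0..T} u'"
  shows "C1_Icc T u"
proof -
  have "continuous_on {0..T} (deriv_Icc T u)"
    by (rule continuous_on_eq[OF assms(3)]) (simp add: deriv_Icc_eq[OF \<open>0 < T\<close> _ u])
  then show ?thesis
    unfolding C1_Icc_def using differentiableI_vector[OF u] by blast
qed

lemma hamiltonian_system_imp_is_solution:
  fixes \<phi> :: "real ^ 'n \<Rightarrow> real ^ 'n"
  assumes sys: "hamiltonian_system T \<psi> h u w" and "0 < T"
    and \<psi>: "continuous_on UNIV \<psi>" "\<And>x. norm (\<psi> x) < a" "\<And>x. \<phi> (\<psi> x) = x"
    and h: "continuous_on {0..T} h" and bc: "(w 0, - w T) \<in> \<gamma> (u 0, u T)"
  shows "is_solution T a \<phi> \<gamma> h u"
proof -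
  have u: "(u has_vector_derivative \<psi> (w t)) (at t within {0..T})"
    and w: "(w has_vector_derivative u t - h t) (at t within {0..T})" if "t \<in> {0..T}" for t
    using sys that by (auto simp: hamiltonian_system_def)
  have du: "deriv_Icc T u t = \<psi> (w t)" if "t \<in> {0..T}" for t
    by (rule deriv_Icc_eq[OF \<open>0 < T\<close> that u[OF that]])
  have w': "((\<lambda>t. \<phi> (deriv_Icc T u t)) has_vector_derivative u t - h t) (at t within {0..T})"
    if "t \<in> {0..T}" for t
    by (rule has_vector_derivative_transform[OF that _ w[OF that]]) (simp add: du \<psi>)
  have dw: "deriv_Icc T (\<lambda>t. \<phi> (deriv_Icc T u t)) t = u t - h t" if "t \<in> {0..T}" for t
    by (rule deriv_Icc_eq[OF \<open>0 < T\<close> that w'[OF that]])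
  have cu: "continuous_on {0..T} u" and cw: "continuous_on {0..T} w"
    using u w has_vector_derivative_continuous
    by (fastforce simp: continuous_on_eq_continuous_within)+
  have "C1_Icc T u"
    by (rule C1_IccI[OF \<open>0 < T\<close> u]) (auto intro: continuous_on_compose2[OF \<psi>(1) cw])
  moreover have "C1_Icc T (\<lambda>t. \<phi> (deriv_Icc T u t))"
    by (rule C1_IccI[OF \<open>0 < T\<close> w']) (auto intro: continuous_on_diff cu h)
  ultimately show ?thesis
    using bc \<open>0 < T\<close> unfolding is_solution_def operator_domain_def
    by (auto simp: du dw \<psi>)
qed

text \<open>Uniqueness means equality on \<open>{0..T}\<close>, because \<open>is_solution\<close>
  does not see the values of a function outside this interval.\<close>

theorem theorem2p8:
  fixes T a :: real
    and \<phi> :: "real ^ 'n \<Rightarrow> real ^ 'n"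
    and \<gamma> :: "(real ^ 'n) \<times> (real ^ 'n) \<Rightarrow> ((real ^ 'n) \<times> (real ^ 'n)) set"
  assumes "0 < T" and "0 < a"
    and "singular_homeomorphism a \<phi>"
    and "maximal_monotone_operator \<gamma>"
    and "0 \<in> \<gamma> 0"
  shows "\<forall>h. continuous_on {0..T} h \<longrightarrow>
           (\<exists>u. is_solution T a \<phi> \<gamma> h u \<and>
                (\<forall>v. is_solution T a \<phi> \<gamma> h v \<longrightarrow> (\<forall>t\<in>{0..T}. v t = u t)))"
proof (intro allI impI)
  fix h :: "real \<Rightarrow> real ^ 'n" assume h: "continuous_on {0..T} h"
  obtain \<psi> where homeo: "homeomorphism (ball 0 a) UNIV \<phi> \<psi>"
    using assms(3) by (auto simp: singular_homeomorphism_def)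
  obtain F where F: "\<And>x. x \<in> ball 0 a \<Longrightarrow> GDERIV F x :> \<phi> x" "strictly_convex_on (cball 0 a) F"
    using assms(3) unfolding singular_homeomorphism_def C1_potential_on_def by blast
  have \<psi>: "continuous_on UNIV \<psi>" "\<psi> w \<in> ball 0 a" "\<phi> (\<psi> w) = w"
    and \<phi>: "continuous_on (ball 0 a) \<phi>" and \<psi>\<phi>: "x \<in> ball 0 a \<Longrightarrow> \<psi> (\<phi> x) = x" for w x
    using homeo by (auto simp: homeomorphism_def)
  have mono\<phi>: "0 \<le> (\<phi> x - \<phi> y) \<bullet> (x - y)" if "x \<in> ball 0 a" "y \<in> ball 0 a" for x y
    using that
    by (intro convex_on_gradient_monotone[OF strictly_convex_on_imp_convex_on[OF F(2)]] F(1)) auto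
  have mono: "0 \<le> (\<psi> x - \<psi> y) \<bullet> (x - y)" for x y
    using mono\<phi>[OF \<psi>(2,2), of x y] by (simp add: \<psi>(3) inner_commute)
  have \<psi>_lt: "norm (\<psi> w) < a" for w using \<psi>(2)[of w] by simp
  \<comment> \<open>Any radius strictly between 0 and \<open>a\<close> gives coercivity;
    \<open>a / 2\<close> is a convenient one.\<close>
  obtain C where C: "\<And>w. a / 2 * norm w - C \<le> \<psi> w \<bullet> w"
    by (rule monotone_inverse_coercive[OF mono\<phi> \<phi> \<psi>(2,3), of "a / 2"]) (use \<open>0 < a\<close> in auto)
  obtain u w where sys: "hamiltonian_system T \<psi> h u w" and bc: "(w 0, - w T) \<in> \<gamma> (u 0, u T)"
    by (rule hamiltonian_inclusion_solvable[OF \<psi>(1) mono C _ less_imp_le[OF \<psi>_lt] \<open>0 < a\<close> h \<open>0 < T\<close>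
          assms(4,5)]) (use \<open>0 < a\<close> in auto)
  have "is_solution T a \<phi> \<gamma> h u"
    by (rule hamiltonian_system_imp_is_solution[where \<gamma> = \<gamma>, OF sys \<open>0 < T\<close> \<psi>(1) \<psi>_lt \<psi>(3) h bc])
  moreover have "v t = u t" if sol: "is_solution T a \<phi> \<gamma> h v" and t: "t \<in> {0..T}" for v t
  proof -
    define z where "z t = \<phi> (deriv_Icc T v t)" for t
    have z: "hamiltonian_system T \<psi> h v z"
      unfolding z_def by (rule is_solution_imp_hamiltonian_system[OF sol]) (simp add: \<psi>\<phi>)
    have "(z 0, - z T) \<in> \<gamma> (v 0, v T)"
      using sol by (simp add: is_solution_def z_def)
    \<comment> \<open>Monotonicity of \<open>\<gamma>\<close> at the two pairs of boundary values
      is, thanks to the minus sign at \<open>T\<close>, the inequality between the end values of the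
      energy that forces uniqueness.\<close>
    with bc assms(4) have "0 \<le> ((z 0, - z T) - (w 0, - w T)) \<bullet> ((v 0, v T) - (u 0, u T))"
      unfolding maximal_monotone_operator_def monotone_operator_def by blast
    then have "(z T - w T) \<bullet> (v T - u T) \<le> (z 0 - w 0) \<bullet> (v 0 - u 0)"
      by (simp add: inner_diff_left)
    from hamiltonian_system_unique[OF mono z sys \<open>0 < T\<close> this t] show ?thesis .
  qed
  ultimately show "\<exists>u. is_solution T a \<phi> \<gamma> h u \<and>
      (\<forall>v. is_solution T a \<phi> \<gamma> h v \<longrightarrow> (\<forall>t\<in>{0..T}. v t = u t))"
    by blast
qed

end
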